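(* Let $\Omega_i=\mathbb R^p$ for all $i$. Suppose each $f_i:\mathbb R^p\to\mathbb R$ is convex and differentiable with $L_i$-Lipschitz gradient, the graph $\mathcal G$ is connected, and $\mathbf L=U^\top U$ satisfies the graph and null-space conditions given in the context. Assume that the problem of minimizing $\sum_{i=1}^nf_i(x_i)$ subject to $\sum_{i=1}^n(x_i-r_i)=0$ has a solution, i.e. $\mathcal X^*\neq\emptyset$. Let $L=\max_iL_i$. If $0<c<\frac1{2L\lambda_{\max}(\mathbf L)}$, then the sequence $\{\mathbf x^k\}$ generated by Mirror-EXTRA converges to a point in $\mathcal X^*$.
   Context: Agents $i=1,\dots,n$ have $f_i:\mathbb R^p\to\mathbb R$ and $r_i\in\mathbb R^p$. Points are matrices $\mathbf x\in\mathbb R^{n\times p}$ with $i$-th row $x_i^\top$. $\mathcal X^*$ is the set of optimal solutions of the stated problem. $\lambda_{\max}$ is the largest eigenvalue. Graph. $\mathcal G$ is a simple undirected graph on $\{1,\dots,n\}$ with edge set $\mathcal E$ and neighbor sets $\mathcal N_i$. The $n\times n$ matrix $\mathbf L=[L_{ij}]$ is compatible with $\mathcal G$ (that is, $L_{ij}=0$ whenever $i\ne j$ and $\{i,j\}\notin\mathcal E$) and $\mathbf L=U^\top U$ for some full-row-rank $U\in\mathbb R^{(n-1)\times n}$ with null space $\{a\mathbf 1: a\in\mathbb R\}$. Algorithm (Mirror-EXTRA). Each agent $i$ initializes with arbitrary $x_i^0\in\mathbb R^p$ and $y_i^{-1}=0$. For $k=0,1,\dots$: $y_i^k=y_i^{k-1}+\sum_{j\in\mathcal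 N_i\cup\{i\}}L_{ij}\nabla f_j(x_j^k)$; $x_i^{k+1}=r_i-2cy_i^k+cy_i^{k-1}$. *)

theory Defs
  imports "HOL-Analysis.Analysis"
begin

definition gradient :: "('a::real_inner \<Rightarrow> real) \<Rightarrow> 'a \<Rightarrow> 'a" where
  "gradient f x = (THE D. GDERIV f x :> D)"

lemma gradient_eqI:
  assumes "GDERIV f x :> D"
  shows "gradient f x = D"
  unfolding gradient_def
proof (rule the_equality)
  show "GDERIV f x :> D" by (fact assms)
next
  fix D' assume "GDERIV f x :> D'"
  then have "(\<lambda>h. inner h D') = (\<lambda>h. inner h D)"
    using assms has_derivative_unique unfolding gderiv_def by blast
  then show "D' = D"
    by (metis vector_eq_ldot)
qed

lemma GDERIV_gradient:
  fixes f :: "'a::euclidean_space \<Rightarrow> real"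
  assumes "f differentiable (at x)"
  shows "GDERIV f x :> gradient f x"
proof -
  obtain f' where f': "(f has_derivative f') (at x)"
    using assms unfolding differentiable_def by blast
  then interpret bounded_linear f'
    by (rule has_derivative_bounded_linear)
  have "f' = (\<lambda>h. inner h (adjoint f' 1))"
    using adjoint_works[OF linear_axioms, of _ 1] by (simp add: fun_eq_iff inner_commute)
  with f' have "GDERIV f x :> adjoint f' 1"
    unfolding gderiv_def by metis
  then show ?thesis
    by (simp add: gradient_eqI)
qed

definition lambda_max :: "real^'n^'n \<Rightarrow> real" where
  "lambda_max A = Max {l. \<exists>v. v \<noteq> 0 \<and> A *v v = l *\<^sub>R v}"

text \<open>A simple undirected graph on the agents is given by its set of edges, which are two-element
  sets of vertices.\<close>

definition simple_graph :: "'n set set \<Rightarrow> bool" where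
  "simple_graph E \<longleftrightarrow> (\<forall>e\<in>E. card e = 2)"

definition neighbors :: "'n set set \<Rightarrow> 'n \<Rightarrow> 'n set" where
  "neighbors E i = {j. {i, j} \<in> E}"

definition connected_graph :: "'n set set \<Rightarrow> bool" where
  "connected_graph E \<longleftrightarrow> (\<forall>i j. (i, j) \<in> {(u, v). {u, v} \<in> E}\<^sup>*)"

definition compatible :: "'n set set \<Rightarrow> real^'n^'n \<Rightarrow> bool" where
  "compatible E L \<longleftrightarrow> (\<forall>i j. i \<noteq> j \<and> {i, j} \<notin> E \<longrightarrow> L $ i $ j = 0)"

text \<open>With \<open>n = CARD('n)\<close>, an \<open>(n - 1) \<times> n\<close> matrix is given by its rows \<open>U 0, \<dots>, U (n - 2)\<close>; the values
  of \<open>U\<close> at larger indices are irrelevant. A matrix type \<open>real^'n^'m\<close> would exclude \<open>n = 1\<close>, since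
  index types are nonempty. As for the library constant \<open>rank\<close>, the rank is the dimension of the
  set of rows.\<close>

definition full_row_rank :: "(nat \<Rightarrow> real^'n) \<Rightarrow> bool" where
  "full_row_rank U \<longleftrightarrow> dim (U ` {..<CARD('n) - 1}) = CARD('n) - 1"

definition null_space :: "(nat \<Rightarrow> real^'n) \<Rightarrow> (real^'n) set" where
  "null_space U = {v. \<forall>k < CARD('n) - 1. U k \<bullet> v = 0}"

definition gram :: "(nat \<Rightarrow> real^'n) \<Rightarrow> real^'n^'n" where
  "gram U = (\<chi> i j. \<Sum>k < CARD('n) - 1. U k $ i * U k $ j)"

definition optimal_solutions ::
  "('n \<Rightarrow> real^'p \<Rightarrow> real) \<Rightarrow> ('n \<Rightarrow> real^'p) \<Rightarrow> (real^'p^'n) set" where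
  "optimal_solutions f r =
     {x. is_arg_min (\<lambda>x. \<Sum>i\<in>UNIV. f i (x $ i)) (\<lambda>x. (\<Sum>i\<in>UNIV. x $ i - r i) = 0) x}"

text \<open>The \<open>k\<close>-th state is the pair \<open>(x\<^sup>k, y\<^sup>k\<^sup>-\<^sup>1)\<close>.\<close>

primrec mirror_extra_state ::
  "'n set set \<Rightarrow> real^'n^'n \<Rightarrow> ('n \<Rightarrow> real^'p \<Rightarrow> real) \<Rightarrow> ('n \<Rightarrow> real^'p) \<Rightarrow> real \<Rightarrow> real^'p^'n
     \<Rightarrow> nat \<Rightarrow> (real^'p^'n) \<times> (real^'p^'n)" where
  "mirror_extra_state E L f r c x0 0 = (x0, 0)"
| "mirror_extra_state E L f r c x0 (Suc k) =
     (let (x, y) = mirror_extra_state E L f r c x0 k;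
          y' = (\<chi> i. y $ i + (\<Sum>j\<in>neighbors E i \<union> {i}. (L $ i $ j) *\<^sub>R gradient (f j) (x $ j)))
      in (\<chi> i. r i - (2 * c) *\<^sub>R (y' $ i) + c *\<^sub>R (y $ i), y'))"

definition mirror_extra ::
  "'n set set \<Rightarrow> real^'n^'n \<Rightarrow> ('n \<Rightarrow> real^'p \<Rightarrow> real) \<Rightarrow> ('n \<Rightarrow> real^'p) \<Rightarrow> real \<Rightarrow> real^'p^'n
     \<Rightarrow> nat \<Rightarrow> real^'p^'n" where
  "mirror_extra E L f r c x0 k = fst (mirror_extra_state E L f r c x0 k)"

end

theory Submission
  imports Defs
begin

text \<open>Write \<open>L = W\<^sup>T W\<close> and \<open>F x = \<Sum>\<^sub>i f\<^sub>i (x\<^sub>i)\<close>, and accumulate the gradients in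
  \<open>w\<^sup>k = \<Sum>\<^sub>j\<^sub><\<^sub>k W \<nabla>F(x\<^sup>j)\<close>. Then \<open>y\<^sup>k\<^sup>-\<^sup>1 = W\<^sup>T w\<^sup>k\<close>, and Mirror-EXTRA becomes
  \<open>w\<^sup>k\<^sup>+\<^sup>1 = w\<^sup>k + W \<nabla>F(x\<^sup>k)\<close>, \<open>x\<^sup>k\<^sup>+\<^sup>1 = r - c W\<^sup>T (2 w\<^sup>k\<^sup>+\<^sup>1 - w\<^sup>k)\<close>. For \<open>k \<ge> 1\<close> the first equation reads
  \<open>w\<^sup>k\<^sup>+\<^sup>1 = w\<^sup>k - \<nabla>\<phi>(2 w\<^sup>k - w\<^sup>k\<^sup>-\<^sup>1)\<close> with \<open>\<phi>(w) = F(r - c W\<^sup>T w) / c\<close>: gradient descent whose gradient is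
  taken at the reflected point. Since the kernel of \<open>W\<close> consists of the consensual vectors, the
  range of \<open>W\<^sup>T\<close> is its orthogonal complement, the matrices whose rows add up to zero
  (\<open>range_transpose_balanced\<close>). So \<open>r - c W\<^sup>T w\<close> runs through exactly the feasible points, and
  such a point \<open>x\<close> is optimal if and only if \<open>W \<nabla>F(x) = 0\<close> (\<open>affine_minimizer_iff\<close>).

  Let \<open>x\<^sup>* = r - c W\<^sup>T w\<^sup>*\<close> be optimal. A convex function whose gradient is \<open>K\<close>-Lipschitz has a cocoercive
  gradient (\<open>gradient_cocoercive\<close>), and \<open>|W v|\<^sup>2 \<le> \<lambda> |v|\<^sup>2\<close> for the largest eigenvalue \<open>\<lambda>\<close> of \<open>L\<close>
  (\<open>quadratic_form_le_lambda_max\<close>). Together they show that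
  \<open>V\<^sub>k = |w\<^sup>k\<^sup>+\<^sup>1 - w\<^sup>*|\<^sup>2 + |w\<^sup>k\<^sup>+\<^sup>1 - w\<^sup>k|\<^sup>2\<close> drops in each step by at least
  \<open>(2 / (c K) - 3 \<lambda>) |\<nabla>F(x\<^sup>k\<^sup>+\<^sup>1) - \<nabla>F(x\<^sup>*)|\<^sup>2\<close> (\<open>reflected_step_decrease\<close>), and the coefficient is
  positive because the bound on \<open>c\<close> gives \<open>3 c K \<lambda> < 2\<close>. Hence the gradients converge to \<open>\<nabla>F(x\<^sup>*)\<close> and \<open>w\<^sup>k\<close> is bounded. Every
  cluster point \<open>u\<close> of \<open>w\<^sup>k\<close> gives an optimal point \<open>r - c W\<^sup>T u\<close>, so \<open>V\<close> formed with \<open>u\<close> in place of \<open>w\<^sup>*\<close>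
  is decreasing too; along a subsequence it tends to zero, so it tends to zero, and the whole
  sequence \<open>w\<^sup>k\<close> converges to \<open>u\<close> (\<open>reflected_dual_iteration_converges\<close>).\<close>

section \<open>Smooth convex functions\<close>

lemma GDERIV_along_line:
  assumes "\<And>x. GDERIV F x :> G x"
  shows "((\<lambda>t. F (x + t *\<^sub>R d)) has_real_derivative inner d (G (x + t *\<^sub>R d))) (at t)"
proof -
  have "((\<lambda>t. x + t *\<^sub>R d) has_derivative (\<lambda>h. h *\<^sub>R d)) (at t)"
    by (auto intro!: derivative_eq_intros)
  moreover have "(F has_derivative (\<lambda>h. inner h (G (x + t *\<^sub>R d)))) (at (x + t *\<^sub>R d))"
    using assms unfolding gderiv_def by blast
  ultimately have "((\<lambda>t. F (x + t *\<^sub>R d)) has_derivative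
      (\<lambda>h. inner (h *\<^sub>R d) (G (x + t *\<^sub>R d)))) (at t)"
    by (rule has_derivative_compose)
  then show ?thesis
    by (simp add: has_field_derivative_def mult_commute_abs)
qed

lemma convex_above_tangent:
  assumes convex: "convex_on UNIV F" and grad: "\<And>x. GDERIV F x :> G x"
  shows "F x + inner (G x) (y - x) \<le> F y"
proof -
  let ?p = "\<lambda>t. F (x + t *\<^sub>R (y - x))"
  have "convex_on UNIV ?p"
  proof (rule convex_onI)
    fix t a b :: real
    assume t: "0 < t" "t < 1"
    have "x + ((1 - t) *\<^sub>R a + t *\<^sub>R b) *\<^sub>R (y - x)
        = (1 - t) *\<^sub>R (x + a *\<^sub>R (y - x)) + t *\<^sub>R (x + b *\<^sub>R (y - x))"
      by (simp add: algebra_simps)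
    then show "?p ((1 - t) *\<^sub>R a + t *\<^sub>R b) \<le> (1 - t) * ?p a + t * ?p b"
      using convex_onD[OF convex, of t "x + a *\<^sub>R (y - x)" "x + b *\<^sub>R (y - x)"] t by simp
  qed simp
  moreover have "(?p has_real_derivative inner (y - x) (G x)) (at 0)"
    using GDERIV_along_line[OF grad, of x "y - x" 0] by simp
  ultimately have "?p 1 - ?p 0 \<ge> inner (y - x) (G x) * (1 - 0)"
    using convex_on_imp_above_tangent[of UNIV ?p 0 1 "inner (y - x) (G x)"] by simp
  then show ?thesis
    by (simp add: inner_commute)
qed

text \<open>Along the segment from \<open>x\<close> to \<open>y\<close> the directional derivative exceeds its initial value by at
  most \<open>K t |y - x|\<^sup>2\<close> at time \<open>t\<close>; integrating gives the quadratic term.\<close>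

lemma quadratic_upper_bound:
  assumes grad: "\<And>x. GDERIV F x :> G x"
    and lipschitz: "\<And>x y. norm (G x - G y) \<le> K * norm (x - y)"
  shows "F y \<le> F x + inner (G x) (y - x) + K / 2 * (norm (y - x))\<^sup>2"
proof -
  define d where "d = y - x"
  define p where "p t = F (x + t *\<^sub>R d) - t * inner (G x) d - K / 2 * t\<^sup>2 * (norm d)\<^sup>2" for t
  have "p 1 \<le> p 0"
  proof (rule DERIV_nonpos_imp_nonincreasing[of 0 1 p])
    fix t :: real
    assume t: "0 \<le> t" "t \<le> 1"
    have "(p has_real_derivative
        inner d (G (x + t *\<^sub>R d)) - inner (G x) d - K * t * (norm d)\<^sup>2) (at t)"
      unfolding p_def
      by (rule derivative_eq_intros GDERIV_along_line[OF grad] refl | simp)+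
    moreover have "inner d (G (x + t *\<^sub>R d)) - inner (G x) d \<le> K * t * (norm d)\<^sup>2"
    proof -
      have "inner d (G (x + t *\<^sub>R d)) - inner (G x) d = inner d (G (x + t *\<^sub>R d) - G x)"
        by (simp add: inner_diff_right inner_commute)
      also have "\<dots> \<le> norm d * norm (G (x + t *\<^sub>R d) - G x)"
        by (rule norm_cauchy_schwarz)
      also have "\<dots> \<le> norm d * (K * (t * norm d))"
        using lipschitz[of "x + t *\<^sub>R d" x] t by (intro mult_left_mono) auto
      finally show ?thesis
        by (simp add: power2_eq_square mult_ac)
    qed
    ultimately show "\<exists>D. (p has_real_derivative D) (at t) \<and> D \<le> 0"
      by force
  qed simp
  then show ?thesis
    by (simp add: p_def d_def)
qed

text \<open>The lower bound from the tangent at \<open>x\<close> and the quadratic upper bound around \<open>y\<close> are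
  compared at the point \<open>z\<close> that a gradient step of length \<open>1 / K\<close> reaches from \<open>y\<close> for the
  function \<open>F - \<langle>\<nabla>F(x), _\<rangle>\<close>, whose minimum is at \<open>x\<close>. This step length minimizes the
  quadratic upper bound of that function.\<close>

lemma convex_smooth_lower_bound:
  assumes convex: "convex_on UNIV F" and grad: "\<And>x. GDERIV F x :> G x"
    and lipschitz: "\<And>x y. norm (G x - G y) \<le> K * norm (x - y)" and "K > 0"
  shows "F x + inner (G x) (y - x) + (norm (G y - G x))\<^sup>2 / (2 * K) \<le> F y"
proof -
  define e where "e = G y - G x"
  define z where "z = y - (1 / K) *\<^sub>R e"
  have zy: "z - y = - (1 / K) *\<^sub>R e"
    by (simp add: z_def)
  have zx: "z - x = (y - x) - (1 / K) *\<^sub>R e"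
    by (simp add: z_def)
  have "F x + inner (G x) (z - x) \<le> F z"
    using convex grad by (rule convex_above_tangent)
  also have "\<dots> \<le> F y + inner (G y) (z - y) + K / 2 * (norm (z - y))\<^sup>2"
    using grad lipschitz by (rule quadratic_upper_bound)
  finally have "F x + inner (G x) (y - x) + inner e e / K - K / 2 * (norm (z - y))\<^sup>2 \<le> F y"
    unfolding zx unfolding zy e_def
    by (simp add: inner_diff_right inner_diff_left diff_divide_distrib add_divide_distrib)
  moreover have "K / 2 * (norm (z - y))\<^sup>2 = (norm e)\<^sup>2 / (2 * K)"
    unfolding zy using \<open>K > 0\<close> by (simp add: power_divide power2_eq_square)
  ultimately show ?thesis
    using \<open>K > 0\<close> by (simp add: e_def power2_norm_eq_inner field_simps)
qed

text \<open>The Baillon--Haddad theorem: add the preceding bound to the same bound with \<open>x\<close> and \<open>y\<close>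
  interchanged.\<close>

lemma gradient_cocoercive:
  assumes "convex_on UNIV F" and "\<And>x. GDERIV F x :> G x"
    and "\<And>x y. norm (G x - G y) \<le> K * norm (x - y)" and "K > 0"
  shows "(norm (G x - G y))\<^sup>2 \<le> K * inner (G x - G y) (x - y)"
  using convex_smooth_lower_bound[OF assms, of x y] convex_smooth_lower_bound[OF assms, of y x] \<open>K > 0\<close>
  by (simp add: norm_minus_commute inner_diff field_simps)

section \<open>Reflected gradient descent in dual variables\<close>

text \<open>With \<open>d = G x - G z\<close> and \<open>b = B (G x) = B d\<close>, expanding \<open>|w' - v|\<^sup>2\<close> produces the cross
  term \<open>2 \<langle>b, w - v\<rangle>\<close>. Cocoercivity controls \<open>\<langle>b, (w - v) + (w - w0)\<rangle>\<close>, because the reflection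
  makes \<open>x - z\<close> equal to \<open>- c Bt ((w - v) + (w - w0))\<close>. The remaining \<open>- 2 \<langle>b, w - w0\<rangle>\<close> is at
  most \<open>|b|\<^sup>2 + |w - w0|\<^sup>2\<close>, and the increment \<open>|w - w0|\<^sup>2\<close> is part of the potential. In total
  \<open>|b|\<^sup>2 \<le> lam |d|\<^sup>2\<close> is spent three times: in the square, in this estimate and in the new
  increment \<open>w' - w = b\<close>.\<close>

lemma reflected_step_decrease:
  fixes B :: "'a::euclidean_space \<Rightarrow> 'b::euclidean_space"
  assumes lin: "linear B" and adj: "\<And>u v. inner (B u) v = inner u (Bt v)"
    and bound: "\<And>v. (norm (B v))\<^sup>2 \<le> lam * (norm v)\<^sup>2"
    and coco: "\<And>x y. (norm (G x - G y))\<^sup>2 \<le> K * inner (G x - G y) (x - y)"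
    and pos: "K > 0" "c > 0"
    and x: "x = r - c *\<^sub>R Bt (2 *\<^sub>R w - w0)"
    and z: "z = r - c *\<^sub>R Bt v" "B (G z) = 0"
    and w': "w' = w + B (G x)"
  shows "(norm (w' - v))\<^sup>2 + (norm (w' - w))\<^sup>2 + (2 / (c * K) - 3 * lam) * (norm (G x - G z))\<^sup>2
    \<le> (norm (w - v))\<^sup>2 + (norm (w - w0))\<^sup>2"
proof -
  define d b p q where "d = G x - G z" and "b = B (G x)" and "p = w - v" and "q = w - w0"
  have b: "b = B d"
    using z(2) by (simp add: d_def b_def linear_diff[OF lin])
  have "inner d (x - z) = - c * inner b (p + q)"
  proof -
    have "inner d (x - z) = c * (inner d (Bt v) - inner d (Bt (2 *\<^sub>R w - w0)))"
      by (simp add: x z inner_diff_right algebra_simps)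
    also have "\<dots> = c * (inner b v - inner b (2 *\<^sub>R w - w0))"
      by (simp add: b adj)
    also have "\<dots> = - c * inner b (p + q)"
      by (simp add: p_def q_def inner_simps algebra_simps)
    finally show ?thesis .
  qed
  then have "(norm d)\<^sup>2 \<le> - (c * K) * inner b (p + q)"
    using coco[of x z] by (simp add: d_def[symmetric] mult_ac)
  then have "2 / (c * K) * (norm d)\<^sup>2 \<le> - 2 * inner b p - 2 * inner b q"
    using pos by (simp add: field_simps inner_simps)
  moreover have "- 2 * inner b q \<le> (norm b)\<^sup>2 + (norm q)\<^sup>2"
    using inner_ge_zero[of "b + q"] by (simp add: power2_norm_eq_inner inner_simps inner_commute)
  moreover have "(norm (w' - v))\<^sup>2 = (norm p)\<^sup>2 + 2 * inner b p + (norm b)\<^sup>2"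
    by (simp add: w' p_def b_def power2_norm_eq_inner inner_simps inner_commute)
  moreover have "w' - w = b"
    by (simp add: w' b_def)
  moreover have "(norm b)\<^sup>2 \<le> lam * (norm d)\<^sup>2"
    unfolding b by (rule bound)
  ultimately show ?thesis
    by (simp add: d_def[symmetric] p_def[symmetric] q_def[symmetric] algebra_simps)
qed

text \<open>The potential \<open>V v\<close> of a solution \<open>v\<close> yields boundedness and the limit of the gradients. A cluster
  point \<open>u\<close> is again a solution, so \<open>V u\<close> also decreases, and its limit can be read off along the
  subsequence. The first step is left out of the potential since \<open>x 0\<close> is arbitrary, whereas \<open>x (Suc k)\<close>
  has the reflected form that the decrease needs.\<close>

lemma reflected_dual_iteration_converges:
  fixes B :: "'a::euclidean_space \<Rightarrow> 'b::euclidean_space"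
  assumes lin: "linear B" "linear Bt" and adj: "\<And>u v. inner (B u) v = inner u (Bt v)"
    and bound: "\<And>v. (norm (B v))\<^sup>2 \<le> lam * (norm v)\<^sup>2"
    and coco: "\<And>x y. (norm (G x - G y))\<^sup>2 \<le> K * inner (G x - G y) (x - y)"
    and cont: "continuous_on UNIV G"
    and pos: "K > 0" "c > 0" and step: "3 * c * K * lam < 2"
    and solution: "B (G (r - c *\<^sub>R Bt v)) = 0"
    and w: "\<And>k. w (Suc k) = w k + B (G (x k))"
    and x: "\<And>k. x (Suc k) = r - c *\<^sub>R Bt (2 *\<^sub>R w (Suc k) - w k)"
  shows "\<exists>u. x \<longlonglongrightarrow> r - c *\<^sub>R Bt u \<and> B (G (r - c *\<^sub>R Bt u)) = 0"
proof -
  define V where "V u k = (norm (w (Suc k) - u))\<^sup>2 + (norm (w (Suc k) - w k))\<^sup>2" for u k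
  define \<delta> where "\<delta> = 2 / (c * K) - 3 * lam"
  define D where "D u k = (norm (G (x (Suc k)) - G (r - c *\<^sub>R Bt u)))\<^sup>2" for u k
  have "\<delta> > 0"
    using pos step by (simp add: \<delta>_def field_simps)
  have V_step: "V u (Suc k) + \<delta> * D u k \<le> V u k" if "B (G (r - c *\<^sub>R Bt u)) = 0" for u k
    unfolding V_def \<delta>_def D_def
    using reflected_step_decrease[OF lin(1) adj bound coco pos x refl that w] .
  have V_decseq: "decseq (V u)" if "B (G (r - c *\<^sub>R Bt u)) = 0" for u
  proof (rule decseq_SucI)
    fix k
    have "0 \<le> \<delta> * D u k"
      using \<open>\<delta> > 0\<close> by (simp add: D_def)
    then show "V u (Suc k) \<le> V u k"
      using V_step[OF that, of k] by linarith
  qed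
  have V_convergent: "\<exists>l. V u \<longlonglongrightarrow> l" if "B (G (r - c *\<^sub>R Bt u)) = 0" for u
    using decseq_convergent[OF V_decseq[OF that], of 0] by (auto simp: V_def)
  have B_tendsto: "(\<lambda>k. B (a k)) \<longlonglongrightarrow> B l" if "a \<longlonglongrightarrow> l" for a l
    using linear_continuous_on[OF linear_conv_bounded_linear[THEN iffD1, OF lin(1)], of UNIV] that
    by (intro continuous_on_tendsto_compose[where f=B and s=UNIV]) auto
  have Bt_tendsto: "(\<lambda>k. Bt (a k)) \<longlonglongrightarrow> Bt l" if "a \<longlonglongrightarrow> l" for a l
    using linear_continuous_on[OF linear_conv_bounded_linear[THEN iffD1, OF lin(2)], of UNIV] that
    by (intro continuous_on_tendsto_compose[where f=Bt and s=UNIV]) auto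
  have G_tendsto: "(\<lambda>k. G (a k)) \<longlonglongrightarrow> G l" if "a \<longlonglongrightarrow> l" for a l
    using cont that by (intro continuous_on_tendsto_compose[where f=G and s=UNIV]) auto
  define g where "g = G (r - c *\<^sub>R Bt v)"
  have grad_lim: "(\<lambda>k. G (x (Suc k))) \<longlonglongrightarrow> g"
  proof -
    obtain l where "V v \<longlonglongrightarrow> l"
      using V_convergent[OF solution] by blast
    then have "(\<lambda>k. (V v k - V v (Suc k)) / \<delta>) \<longlonglongrightarrow> (l - l) / \<delta>"
      using \<open>\<delta> > 0\<close> by (intro tendsto_intros LIMSEQ_Suc) auto
    then have "(\<lambda>k. (V v k - V v (Suc k)) / \<delta>) \<longlonglongrightarrow> 0"
      by simp
    moreover have "norm (D v k) \<le> (V v k - V v (Suc k)) / \<delta>" for k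
      using V_step[OF solution, of k] \<open>\<delta> > 0\<close> by (simp add: D_def field_simps)
    ultimately have "D v \<longlonglongrightarrow> 0"
      by (intro Lim_null_comparison[of "D v"] always_eventually allI)
    then have "(\<lambda>k. sqrt (D v k)) \<longlonglongrightarrow> sqrt 0"
      by (rule tendsto_real_sqrt)
    then show ?thesis
      by (simp add: D_def g_def tendsto_norm_zero_iff LIM_zero_iff)
  qed
  have increment_lim: "(\<lambda>k. w (Suc k) - w k) \<longlonglongrightarrow> 0"
  proof -
    have "(\<lambda>k. w (Suc (Suc k)) - w (Suc k)) \<longlonglongrightarrow> 0"
      using B_tendsto[OF grad_lim] solution by (simp add: w g_def)
    then show ?thesis
      by (rule LIMSEQ_imp_Suc)
  qed
  have "bounded (range (\<lambda>k. w (Suc k)))"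
  proof -
    have "norm (w (Suc k) - v) \<le> sqrt (V v 0)" for k
    proof -
      have "(norm (w (Suc k) - v))\<^sup>2 \<le> V v k"
        by (simp add: V_def)
      also have "\<dots> \<le> V v 0"
        using V_decseq[OF solution] by (simp add: decseqD)
      finally show ?thesis
        by (rule real_le_rsqrt)
    qed
    then have "range (\<lambda>k. w (Suc k)) \<subseteq> cball v (sqrt (V v 0))"
      by (auto simp: dist_norm norm_minus_commute)
    then show ?thesis
      using bounded_cball bounded_subset by blast
  qed
  then obtain u s where s: "strict_mono s" and u: "((\<lambda>k. w (Suc k)) \<circ> s) \<longlonglongrightarrow> u"
    using bounded_imp_convergent_subsequence by blast
  have x_lim: "(\<lambda>k. x (Suc (a k))) \<longlonglongrightarrow> r - c *\<^sub>R Bt u'"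
    if a: "strict_mono a" and u': "(\<lambda>k. w (Suc (a k))) \<longlonglongrightarrow> u'" for a u'
  proof -
    have "(\<lambda>k. w (Suc (a k)) - w (a k)) \<longlonglongrightarrow> 0"
      using LIMSEQ_subseq_LIMSEQ[OF increment_lim a] by (simp add: o_def)
    from tendsto_add[OF u' this]
    have "(\<lambda>k. 2 *\<^sub>R w (Suc (a k)) - w (a k)) \<longlonglongrightarrow> u'"
      by (simp add: scaleR_2 algebra_simps)
    then show ?thesis
      unfolding x by (intro tendsto_intros Bt_tendsto)
  qed
  \<comment> \<open>By continuity the gradient at the cluster point is the limit \<open>g\<close> of all gradients, which \<open>B\<close> kills.\<close>
  have opt: "B (G (r - c *\<^sub>R Bt u)) = 0"
  proof -
    have "(\<lambda>k. G (x (Suc (s k)))) \<longlonglongrightarrow> G (r - c *\<^sub>R Bt u)"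
      using x_lim[OF s] u by (intro G_tendsto) (simp add: o_def)
    moreover have "(\<lambda>k. G (x (Suc (s k)))) \<longlonglongrightarrow> g"
      using LIMSEQ_subseq_LIMSEQ[OF grad_lim s] by (simp add: o_def)
    ultimately show ?thesis
      using LIMSEQ_unique solution g_def by metis
  qed
  obtain l where l: "V u \<longlonglongrightarrow> l"
    using V_convergent[OF opt] by blast
  have "(V u \<circ> s) \<longlonglongrightarrow> (norm (u - u))\<^sup>2 + (norm (0 :: 'b))\<^sup>2"
    unfolding V_def o_def using u LIMSEQ_subseq_LIMSEQ[OF increment_lim s]
    by (intro tendsto_intros) (simp_all add: o_def)
  then have "l = 0"
    using LIMSEQ_subseq_LIMSEQ[OF l s] LIMSEQ_unique by fastforce
  have "(\<lambda>k. (norm (w (Suc k) - u))\<^sup>2) \<longlonglongrightarrow> 0"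
    using Lim_null_comparison[of "\<lambda>k. (norm (w (Suc k) - u))\<^sup>2" "V u"] l \<open>l = 0\<close>
    by (auto simp: V_def)
  then have "(\<lambda>k. w (Suc k)) \<longlonglongrightarrow> u"
    by (simp add: tendsto_norm_zero_iff LIM_zero_iff)
  then have "(\<lambda>k. x (Suc k)) \<longlonglongrightarrow> r - c *\<^sub>R Bt u"
    using x_lim[of "\<lambda>k. k"] by (simp add: strict_mono_def)
  then show ?thesis
    using opt LIMSEQ_imp_Suc by blast
qed


text \<open>The gradient at a minimizer is orthogonal to the directions in the range of \<open>Bt\<close>; this is
  tested with the single direction \<open>d = Bt (B (G z))\<close>, for which \<open>\<langle>d, G z\<rangle> = |B (G z)|\<^sup>2\<close>.
  Conversely, for a gradient killed by \<open>B\<close> the tangent at \<open>z\<close> is constant on the affine space and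
  bounds \<open>F\<close> from below there.\<close>

lemma affine_minimizer_iff:
  fixes F :: "'a::real_inner \<Rightarrow> real" and B :: "'a \<Rightarrow> 'b::real_inner"
  assumes Bt: "linear Bt" and adj: "\<And>u v. inner (B u) v = inner u (Bt v)"
    and convex: "convex_on UNIV F" and grad: "\<And>x. GDERIV F x :> G x"
    and feasible: "z - r \<in> range Bt"
  shows "is_arg_min F (\<lambda>x. x - r \<in> range Bt) z \<longleftrightarrow> B (G z) = 0"
proof
  assume min: "is_arg_min F (\<lambda>x. x - r \<in> range Bt) z"
  define d where "d = Bt (B (G z))"
  have "inner d (G (z + 0 *\<^sub>R d)) = 0"
  proof (rule DERIV_local_min[OF GDERIV_along_line[OF grad] zero_less_one], intro allI impI)
    fix t :: real
    obtain u where "z - r = Bt u"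
      using feasible by blast
    then have "z + t *\<^sub>R d - r = Bt (u + t *\<^sub>R B (G z))"
      using Bt by (simp add: d_def linear_add linear_scale algebra_simps)
    then show "F (z + 0 *\<^sub>R d) \<le> F (z + t *\<^sub>R d)"
      using min unfolding is_arg_min_def by (simp add: not_less)
  qed
  then show "B (G z) = 0"
    using adj[of "G z" "B (G z)"] by (simp add: d_def inner_commute)
next
  assume stationary: "B (G z) = 0"
  have "F z \<le> F y" if y: "y - r \<in> range Bt" for y
  proof -
    obtain u v where uv: "z - r = Bt u" "y - r = Bt v"
      using feasible y by blast
    have "y - z = (y - r) - (z - r)"
      by simp
    also have "\<dots> = Bt (v - u)"
      using Bt by (simp add: uv linear_diff)
    finally have "inner (G z) (y - z) = 0"
      using adj[of "G z" "v - u"] stationary by simp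
    then show ?thesis
      using convex_above_tangent[OF convex grad, of z y] by simp
  qed
  then show "is_arg_min F (\<lambda>x. x - r \<in> range Bt) z"
    using feasible by (auto simp: is_arg_min_def not_less)
qed

lemma reflected_dual_iteration_converges_to_minimizer:
  fixes B :: "'a::euclidean_space \<Rightarrow> 'b::euclidean_space"
  assumes lin: "linear B" "linear Bt" and adj: "\<And>u v. inner (B u) v = inner u (Bt v)"
    and bound: "\<And>v. (norm (B v))\<^sup>2 \<le> lam * (norm v)\<^sup>2" "lam \<ge> 0"
    and convex: "convex_on UNIV F" and grad: "\<And>x. GDERIV F x :> G x"
    and lipschitz: "M-lipschitz_on UNIV G"
    and step: "c > 0" "3 * c * M * lam < 2"
    and solvable: "is_arg_min F (\<lambda>x. x - r \<in> range Bt) z"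
    and w: "\<And>k. w (Suc k) = w k + B (G (x k))"
    and x: "\<And>k. x (Suc k) = r - c *\<^sub>R Bt (2 *\<^sub>R w (Suc k) - w k)"
  shows "\<exists>z. is_arg_min F (\<lambda>x. x - r \<in> range Bt) z \<and> x \<longlonglongrightarrow> z"
proof -
  have iff: "is_arg_min F (\<lambda>x. x - r \<in> range Bt) (r - c *\<^sub>R Bt v) \<longleftrightarrow> B (G (r - c *\<^sub>R Bt v)) = 0" for v
  proof (rule affine_minimizer_iff[OF lin(2) adj convex grad])
    have "r - c *\<^sub>R Bt v - r = Bt (- c *\<^sub>R v)"
      using lin(2) by (simp add: linear_scale linear_neg)
    then show "r - c *\<^sub>R Bt v - r \<in> range Bt"
      by (metis rangeI)
  qed
  \<comment> \<open>Cocoercivity needs a positive Lipschitz constant, but \<open>M\<close> may be 0. The strict step size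
    condition leaves room to enlarge \<open>M\<close> slightly.\<close>
  define K where "K = M + (2 - 3 * c * M * lam) / (6 * c * (lam + 1))"
  have "M \<ge> 0"
    using lipschitz by (rule lipschitz_on_nonneg)
  moreover have "(2 - 3 * c * M * lam) / (6 * c * (lam + 1)) > 0"
    using step bound(2) by simp
  ultimately have K: "K > 0" "M \<le> K"
    by (simp_all add: K_def)
  have K_step: "3 * c * K * lam < 2"
  proof -
    have "3 * c * K * lam = 3 * c * M * lam + (2 - 3 * c * M * lam) * (lam / (2 * (lam + 1)))"
      using step bound(2) by (simp add: K_def divide_simps) (simp add: algebra_simps)
    also have "\<dots> < 3 * c * M * lam + (2 - 3 * c * M * lam) * 1"
      using step bound(2) by (intro add_strict_left_mono mult_strict_left_mono) (auto simp: field_simps)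
    finally show ?thesis
      by simp
  qed
  have "norm (G x - G y) \<le> K * norm (x - y)" for x y
  proof -
    have "norm (G x - G y) \<le> M * norm (x - y)"
      using lipschitz_onD[OF lipschitz, of x y] by (simp add: dist_norm)
    also have "\<dots> \<le> K * norm (x - y)"
      using K by (simp add: mult_right_mono)
    finally show ?thesis .
  qed
  then have coco: "(norm (G x - G y))\<^sup>2 \<le> K * inner (G x - G y) (x - y)" for x y
    using gradient_cocoercive[OF convex grad _ K(1)] by blast
  have cont: "continuous_on UNIV G"
    using lipschitz by (rule lipschitz_on_continuous_on)
  obtain u where "z - r = Bt u"
    using solvable by (auto simp: is_arg_min_def)
  then have "z = r - c *\<^sub>R Bt (- (1 / c) *\<^sub>R u)"
    using lin(2) step by (simp add: linear_scale linear_neg algebra_simps)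
  then have "B (G (r - c *\<^sub>R Bt (- (1 / c) *\<^sub>R u))) = 0"
    using solvable iff by metis
  then show ?thesis
    using reflected_dual_iteration_converges[where G = G and w = w and x = x,
        OF lin adj bound(1) coco cont K(1) step(1) K_step _ w x] iff
    by blast
qed

section \<open>The largest eigenvalue\<close>

text \<open>Otherwise the form would become negative at \<open>v - t N v\<close> for small \<open>t > 0\<close>, where its linear
  term \<open>- 2 t |N v|\<^sup>2\<close> dominates.\<close>

lemma psd_form_zero_imp_kernel:
  assumes "linear N" and sym: "\<And>x y. inner (N x) y = inner x (N y)"
    and psd: "\<And>x. inner x (N x) \<ge> 0" and zero: "inner v (N v) = 0"
  shows "N v = 0"
proof (rule ccontr)
  assume "N v \<noteq> 0"
  define a b where "a = inner (N v) (N v)" and "b = inner (N v) (N (N v))"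
  (* Any t in the open interval from 0 to 2 * a / b works; the summand 1 covers b = 0. *)
  define t where "t = a / (b + 1)"
  have "a > 0" "b \<ge> 0"
    using \<open>N v \<noteq> 0\<close> psd by (simp_all add: a_def b_def)
  have "0 \<le> inner (v - t *\<^sub>R N v) (N (v - t *\<^sub>R N v))"
    by (rule psd)
  also have "\<dots> = t * (t * b - 2 * a)"
  proof -
    have "inner v (N (N v)) = a"
      by (simp add: a_def sym)
    moreover have "N (v - t *\<^sub>R N v) = N v - t *\<^sub>R N (N v)"
      using \<open>linear N\<close> by (simp add: linear_diff linear_scale)
    ultimately show ?thesis
      using zero by (simp add: inner_diff a_def[symmetric] b_def[symmetric] right_diff_distrib)
  qed
  also have "\<dots> < 0"
  proof (rule mult_pos_neg)
    show "t > 0"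
      using \<open>a > 0\<close> \<open>b \<ge> 0\<close> by (simp add: t_def)
    have "t * b \<le> a"
      using \<open>a > 0\<close> \<open>b \<ge> 0\<close> by (simp add: t_def field_simps)
    then show "t * b - 2 * a < 0"
      using \<open>a > 0\<close> by linarith
  qed
  finally show False
    by simp
qed

lemma symmetric_matrix_inner:
  fixes A :: "real^'n^'n"
  assumes "transpose A = A"
  shows "inner (A *v x) y = inner x (A *v y)"
  using dot_lmul_matrix[of x A y] transpose_matrix_vector[of A x] by (simp only: assms)

text \<open>Eigenvectors of different eigenvalues are orthogonal, hence independent. Finiteness makes the
  \<open>Max\<close> in \<open>lambda_max\<close> meaningful.\<close>

lemma finite_eigenvalues_symmetric:
  fixes A :: "real^'n^'n"
  assumes sym: "transpose A = A"
  shows "finite {l. \<exists>v. v \<noteq> 0 \<and> A *v v = l *\<^sub>R v}" (is "finite ?S")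
proof -
  have "\<forall>l\<in>?S. \<exists>v. v \<noteq> 0 \<and> A *v v = l *\<^sub>R v"
    by simp
  then have "\<exists>e. \<forall>l\<in>?S. e l \<noteq> 0 \<and> A *v e l = l *\<^sub>R e l"
    by (rule bchoice)
  then obtain e where e: "\<And>l. l \<in> ?S \<Longrightarrow> e l \<noteq> 0" "\<And>l. l \<in> ?S \<Longrightarrow> A *v e l = l *\<^sub>R e l"
    by auto
  have orth: "inner (e l) (e m) = 0" if "l \<in> ?S" "m \<in> ?S" "l \<noteq> m" for l m
  proof -
    have "l * inner (e l) (e m) = inner (A *v e l) (e m)"
      by (simp only: e(2)[OF that(1)] inner_scaleR_left)
    also have "\<dots> = inner (e l) (A *v e m)"
      by (rule symmetric_matrix_inner[OF sym])
    also have "\<dots> = m * inner (e l) (e m)"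
      by (simp only: e(2)[OF that(2)] inner_scaleR_right)
    finally show ?thesis
      using that(3) by simp
  qed
  have "inj_on e ?S"
  proof (rule inj_onI, rule ccontr)
    fix l m
    assume "l \<in> ?S" "m \<in> ?S" "e l = e m" "l \<noteq> m"
    then show False
      using orth[of l m] e(1)[of m] by simp
  qed
  moreover have "independent (e ` ?S)"
  proof (rule pairwise_orthogonal_independent)
    show "pairwise orthogonal (e ` ?S)"
      unfolding pairwise_def orthogonal_def using orth by blast
    show "0 \<notin> e ` ?S"
      using e(1) by (metis (no_types, lifting) imageE)
  qed
  then have "finite (e ` ?S)"
    by (rule independent_imp_finite)
  ultimately show ?thesis
    using finite_imageD by blast
qed

text \<open>The form attains its maximum \<open>m\<close> over the unit sphere at some \<open>e\<close>. Then \<open>m I - A\<close> is positive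
  semidefinite and its form vanishes at \<open>e\<close>, so \<open>e\<close> is an eigenvector for \<open>m\<close>.\<close>

lemma quadratic_form_le_lambda_max:
  fixes A :: "real^'n^'n"
  assumes sym: "transpose A = A"
  shows "inner v (A *v v) \<le> lambda_max A * (norm v)\<^sup>2"
proof -
  have "\<exists>e\<in>sphere (0::real^'n) 1. \<forall>x\<in>sphere 0 1. inner x (A *v x) \<le> inner e (A *v e)"
    by (intro continuous_attains_sup continuous_intros compact_sphere) auto
  then obtain e where e: "norm e = 1" and max: "\<And>x. norm x = 1 \<Longrightarrow> inner x (A *v x) \<le> inner e (A *v e)"
    by auto
  define m where "m = inner e (A *v e)"
  have quad: "inner x (A *v x) \<le> m * inner x x" for x
  proof (cases "x = 0")
    case False
    define y where "y = (1 / norm x) *\<^sub>R x"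
    have "norm y = 1" and x: "norm x *\<^sub>R y = x"
      using False by (simp_all add: y_def)
    have "inner x (A *v x) = inner (norm x *\<^sub>R y) (A *v (norm x *\<^sub>R y))"
      unfolding x by (rule refl)
    also have "\<dots> = (norm x)\<^sup>2 * inner y (A *v y)"
      by (simp only: matrix_vector_mult_scaleR inner_scaleR_left inner_scaleR_right power2_eq_square mult.assoc)
    also have "\<dots> \<le> (norm x)\<^sup>2 * m"
      unfolding m_def using max[OF \<open>norm y = 1\<close>] by (simp add: mult_left_mono)
    finally show ?thesis
      by (simp add: dot_square_norm mult.commute)
  qed simp
  define N where "N x = m *\<^sub>R x - A *v x" for x
  have "N e = 0"
  proof (rule psd_form_zero_imp_kernel[of N])
    show "linear N"
      by (rule linearI) (simp_all add: N_def matrix_vector_right_distrib matrix_vector_mult_scaleR algebra_simps)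
    show "inner (N x) y = inner x (N y)" for x y
      by (simp add: N_def inner_simps symmetric_matrix_inner[OF sym])
    show "0 \<le> inner x (N x)" for x
      using quad[of x] by (simp add: N_def inner_simps)
    show "inner e (N e) = 0"
      using e by (simp add: N_def inner_simps m_def dot_square_norm)
  qed
  then have "A *v e = m *\<^sub>R e"
    by (simp add: N_def)
  moreover have "e \<noteq> 0"
    using e by auto
  ultimately have "m \<le> lambda_max A"
    unfolding lambda_max_def using finite_eigenvalues_symmetric[OF sym] by (intro Max_ge) auto
  then have "m * inner v v \<le> lambda_max A * inner v v"
    by (simp add: mult_right_mono)
  then show ?thesis
    using quad[of v] by (simp add: dot_square_norm)
qed


section \<open>The factor of the mixing matrix\<close>

lemma matrix_mult_adjoint:
  fixes W :: "real^'n^'m" and x :: "real^'p^'n" and y :: "real^'p^'m"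
  shows "inner (W ** x) y = inner x (transpose W ** y)"
proof -
  have "inner (W ** x) y = (\<Sum>a\<in>UNIV. \<Sum>q\<in>UNIV. \<Sum>i\<in>UNIV. W $ a $ i * x $ i $ q * y $ a $ q)"
    by (simp add: inner_vec_def matrix_matrix_mult_def sum_distrib_right)
  also have "\<dots> = (\<Sum>q\<in>UNIV. \<Sum>a\<in>UNIV. \<Sum>i\<in>UNIV. W $ a $ i * x $ i $ q * y $ a $ q)"
    by (rule sum.swap)
  also have "\<dots> = (\<Sum>q\<in>UNIV. \<Sum>i\<in>UNIV. \<Sum>a\<in>UNIV. W $ a $ i * x $ i $ q * y $ a $ q)"
    by (intro sum.cong refl sum.swap)
  also have "\<dots> = (\<Sum>i\<in>UNIV. \<Sum>q\<in>UNIV. \<Sum>a\<in>UNIV. W $ a $ i * x $ i $ q * y $ a $ q)"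
    by (rule sum.swap)
  also have "\<dots> = inner x (transpose W ** y)"
    by (simp add: inner_vec_def matrix_matrix_mult_def transpose_def sum_distrib_left mult_ac)
  finally show ?thesis .
qed

lemma linear_matrix_mult: "linear (\<lambda>x :: real^'p^'n. (W :: real^'n^'m) ** x)"
  by (rule linearI) (simp_all add: vec_eq_iff matrix_matrix_mult_def sum.distrib sum_distrib_left algebra_simps)

lemma column_matrix_mult:
  fixes W :: "real^'n^'m" and x :: "real^'p^'n"
  shows "column q (W ** x) = W *v column q x"
  by (simp add: vec_eq_iff column_def matrix_matrix_mult_def matrix_vector_mult_def)

lemma norm_eq_sum_columns:
  fixes x :: "real^'p^'n"
  shows "(norm x)\<^sup>2 = (\<Sum>q\<in>UNIV. (norm (column q x))\<^sup>2)"
  unfolding power2_norm_eq_inner by (simp add: inner_vec_def column_def) (rule sum.swap)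

lemma norm_matrix_mult_le:
  fixes W :: "real^'n^'m" and x :: "real^'p^'n"
  assumes "\<And>v. (norm (W *v v))\<^sup>2 \<le> b * (norm v)\<^sup>2"
  shows "(norm (W ** x))\<^sup>2 \<le> b * (norm x)\<^sup>2"
  unfolding norm_eq_sum_columns column_matrix_mult sum_distrib_left
  by (intro sum_mono assms)

text \<open>Padding the \<open>n - 1\<close> rows of \<open>U\<close> by a zero row changes neither the Gram matrix nor the null
  space, and gives a square matrix also for \<open>n = 1\<close>.\<close>

lemma gram_factor:
  fixes U :: "nat \<Rightarrow> real^'n"
  obtains W :: "real^'n^'n"
  where "gram U = transpose W ** W" and "\<And>v. W *v v = 0 \<longleftrightarrow> v \<in> null_space U"
proof -
  let ?n = "CARD('n)"
  obtain h :: "'n \<Rightarrow> nat" where h: "bij_betw h UNIV {0..<?n}"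
    using ex_bij_betw_finite_nat[of "UNIV :: 'n set"] by auto
  define W :: "real^'n^'n" where "W = (\<chi> a. if h a < ?n - 1 then U (h a) else 0)"
  show ?thesis
  proof
    have "gram U $ i $ j = (transpose W ** W) $ i $ j" for i j
    proof -
      have "(transpose W ** W) $ i $ j
          = (\<Sum>a\<in>UNIV. if h a < ?n - 1 then U (h a) $ i * U (h a) $ j else 0)"
        by (auto simp: W_def matrix_matrix_mult_def transpose_def intro!: sum.cong)
      also have "\<dots> = (\<Sum>k\<in>{0..<?n}. if k < ?n - 1 then U k $ i * U k $ j else 0)"
        using h by (rule sum.reindex_bij_betw)
      also have "\<dots> = (\<Sum>k<?n - 1. U k $ i * U k $ j)"
        by (rule sum.mono_neutral_cong_right) auto
      finally show ?thesis
        by (simp add: gram_def)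
    qed
    then show "gram U = transpose W ** W"
      by (simp add: vec_eq_iff)
  next
    fix v :: "real^'n"
    have "W *v v = 0 \<longleftrightarrow> (\<forall>a. h a < ?n - 1 \<longrightarrow> inner (U (h a)) v = 0)"
      by (auto simp: vec_eq_iff matrix_vector_mul_component W_def)
    also have "\<dots> \<longleftrightarrow> (\<forall>k<?n - 1. inner (U k) v = 0)"
    proof -
      have "\<exists>a. h a = k" if "k < ?n - 1" for k
      proof -
        have "k \<in> h ` UNIV"
          using h that by (auto simp: bij_betw_def)
        then show ?thesis
          by auto
      qed
      then show ?thesis
        by metis
    qed
    finally show "W *v v = 0 \<longleftrightarrow> v \<in> null_space U"
      by (simp add: null_space_def)
  qed
qed

text \<open>A matrix is killed by \<open>W\<close> if and only if each of its columns is constant, that is, all its rows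
  agree.\<close>

lemma kernel_consensus:
  fixes W :: "real^'n^'m" and x :: "real^'p^'n"
  assumes kernel: "\<And>v. W *v v = 0 \<longleftrightarrow> (\<exists>a. v = a *\<^sub>R (\<chi> i. 1))"
  shows "W ** x = 0 \<longleftrightarrow> (\<exists>d. x = (\<chi> i. d))"
proof -
  have "W ** x = 0 \<longleftrightarrow> (\<forall>q. column q (W ** x) = 0)"
    by (auto simp: vec_eq_iff column_def)
  also have "\<dots> \<longleftrightarrow> (\<forall>q. \<exists>a. \<forall>i. x $ i $ q = a)"
    unfolding column_matrix_mult kernel by (simp add: vec_eq_iff column_def)
  also have "\<dots> \<longleftrightarrow> (\<exists>a. \<forall>q i. x $ i $ q = a q)"
    by (rule choice_iff)
  also have "\<dots> \<longleftrightarrow> (\<exists>d :: real^'p. \<forall>q i. x $ i $ q = d $ q)"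
    by (metis vec_lambda_beta)
  also have "\<dots> \<longleftrightarrow> (\<exists>d. x = (\<chi> i. d))"
    by (auto simp: vec_eq_iff)
  finally show ?thesis .
qed

text \<open>The component \<open>t\<close> of \<open>y\<close> orthogonal to the range of \<open>Bt\<close> lies in the kernel of \<open>B\<close>, so it is
  orthogonal to \<open>y\<close> as well and vanishes.\<close>

lemma orthogonal_kernel_imp_range_adjoint:
  fixes B :: "'a::euclidean_space \<Rightarrow> 'b::real_inner"
  assumes "linear Bt" and adj: "\<And>u v. inner (B u) v = inner u (Bt v)"
    and orth: "\<And>v. B v = 0 \<Longrightarrow> inner y v = 0"
  shows "y \<in> range Bt"
proof -
  have "subspace (range Bt)"
    using \<open>linear Bt\<close> by (simp add: linear_subspace_image)
  then obtain s t where st: "s \<in> range Bt" "\<And>u. u \<in> range Bt \<Longrightarrow> orthogonal t u" "y = s + t"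
    using orthogonal_subspace_decomp_exists[of "range Bt" y] by (metis span_eq_iff)
  have "inner (B t) (B t) = 0"
    using adj[of t "B t"] st(2)[of "Bt (B t)"] by (simp add: orthogonal_def)
  then have "inner y t = 0"
    by (intro orth) simp
  moreover have "inner s t = 0"
    using st(1,2) by (simp add: orthogonal_def inner_commute)
  ultimately have "t = 0"
    by (simp add: st(3) inner_add_left)
  then show ?thesis
    using st by simp
qed

text \<open>The matrices with equal rows form the kernel of \<open>W\<close>, and orthogonality to all of them says that
  the rows of \<open>y\<close> add up to zero.\<close>

lemma range_transpose_balanced:
  fixes W :: "real^'n^'m" and y :: "real^'p^'n"
  assumes kernel: "\<And>v. W *v v = 0 \<longleftrightarrow> (\<exists>a. v = a *\<^sub>R (\<chi> i. 1))"
  shows "y \<in> range (\<lambda>w :: real^'p^'m. transpose W ** w) \<longleftrightarrow> (\<Sum>i\<in>UNIV. y $ i) = 0"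
proof -
  have inner_const: "inner y (\<chi> i. d) = inner (\<Sum>i\<in>UNIV. y $ i) d" for d
    by (simp add: inner_vec_def[of y] inner_sum_left)
  show ?thesis
  proof
    assume "y \<in> range (\<lambda>w :: real^'p^'m. transpose W ** w)"
    then obtain w :: "real^'p^'m" where y: "y = transpose W ** w"
      by blast
    define d where "d = (\<Sum>i\<in>UNIV. y $ i)"
    have "W ** (\<chi> i. d) = 0"
      using kernel_consensus[OF kernel] by blast
    then have "inner y (\<chi> i. d) = 0"
      using matrix_mult_adjoint[of W "\<chi> i. d" w] by (simp add: y inner_commute)
    then show "(\<Sum>i\<in>UNIV. y $ i) = 0"
      unfolding inner_const by (simp add: d_def[symmetric])
  next
    assume "(\<Sum>i\<in>UNIV. y $ i) = 0"
    then have "inner y v = 0" if "W ** v = 0" for v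
      using that unfolding kernel_consensus[OF kernel] by (auto simp: inner_const)
    then show "y \<in> range (\<lambda>w :: real^'p^'m. transpose W ** w)"
      by (rule orthogonal_kernel_imp_range_adjoint[OF linear_matrix_mult matrix_mult_adjoint])
  qed
qed

section \<open>Separable objectives\<close>

lemma convex_on_separable:
  fixes f :: "'n::finite \<Rightarrow> 'a::real_vector \<Rightarrow> real"
  assumes "\<And>i. convex_on UNIV (f i)"
  shows "convex_on UNIV (\<lambda>x :: 'a^'n. \<Sum>i\<in>UNIV. f i (x $ i))"
proof (rule convex_onI)
  fix t :: real and x y :: "'a^'n"
  assume "0 < t" "t < 1"
  then have "(\<Sum>i\<in>UNIV. f i (((1 - t) *\<^sub>R x + t *\<^sub>R y) $ i))
      \<le> (\<Sum>i\<in>UNIV. (1 - t) * f i (x $ i) + t * f i (y $ i))"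
    using convex_onD[OF assms, of t "x $ _" "y $ _"] by (intro sum_mono) simp
  then show "(\<Sum>i\<in>UNIV. f i (((1 - t) *\<^sub>R x + t *\<^sub>R y) $ i))
      \<le> (1 - t) * (\<Sum>i\<in>UNIV. f i (x $ i)) + t * (\<Sum>i\<in>UNIV. f i (y $ i))"
    by (simp add: sum.distrib sum_distrib_left)
qed simp

lemma GDERIV_separable:
  fixes f :: "'n::finite \<Rightarrow> 'a::real_inner \<Rightarrow> real" and x :: "'a^'n"
  assumes "\<And>i. GDERIV (f i) (x $ i) :> g i"
  shows "GDERIV (\<lambda>x. \<Sum>i\<in>UNIV. f i (x $ i)) x :> (\<chi> i. g i)"
proof -
  have "((\<lambda>x. f i (x $ i)) has_derivative (\<lambda>h. inner (h $ i) (g i))) (at x)" for i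
  proof (rule has_derivative_compose[where f = "\<lambda>x. x $ i" and g = "f i"])
    show "((\<lambda>x. x $ i) has_derivative (\<lambda>h. h $ i)) (at x)"
      by (rule bounded_linear.has_derivative[OF bounded_linear_vec_nth has_derivative_ident])
    show "(f i has_derivative (\<lambda>h. inner h (g i))) (at (x $ i))"
      using assms unfolding gderiv_def .
  qed
  then have "((\<lambda>x. \<Sum>i\<in>UNIV. f i (x $ i)) has_derivative (\<lambda>h. \<Sum>i\<in>UNIV. inner (h $ i) (g i))) (at x)"
    by (intro has_derivative_sum)
  then show ?thesis
    by (simp add: gderiv_def inner_vec_def)
qed

lemma lipschitz_on_separable:
  fixes g :: "'n::finite \<Rightarrow> 'a::real_normed_vector \<Rightarrow> 'b::real_normed_vector"
  assumes "\<And>i. (l i)-lipschitz_on UNIV (g i)"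
  shows "(Max (range l))-lipschitz_on UNIV (\<lambda>x. \<chi> i. g i (x $ i))"
proof (rule lipschitz_onI)
  have l: "l i \<le> Max (range l)" "0 \<le> l i" for i
    using lipschitz_on_nonneg[OF assms] by simp_all
  show max: "0 \<le> Max (range l)"
    using l order_trans by blast
  fix x y :: "'a^'n"
  have "norm ((\<chi> i. g i (x $ i)) - (\<chi> i. g i (y $ i))) \<le> L2_set (\<lambda>i. Max (range l) * norm ((x - y) $ i)) UNIV"
    unfolding norm_vec_def
  proof (rule L2_set_mono)
    fix i
    have "norm (g i (x $ i) - g i (y $ i)) \<le> l i * norm (x $ i - y $ i)"
      using lipschitz_onD[OF assms, of "x $ i" "y $ i" i] by (simp add: dist_norm)
    also have "\<dots> \<le> Max (range l) * norm (x $ i - y $ i)"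
      by (intro mult_right_mono l norm_ge_zero)
    finally show "norm (((\<chi> i. g i (x $ i)) - (\<chi> i. g i (y $ i))) $ i) \<le> Max (range l) * norm ((x - y) $ i)"
      by simp
  qed simp
  then show "dist (\<chi> i. g i (x $ i)) (\<chi> i. g i (y $ i)) \<le> Max (range l) * dist x y"
    using max by (simp add: dist_norm norm_vec_def L2_set_right_distrib)
qed

section \<open>Mirror-EXTRA\<close>

lemma compatible_neighbor_sum:
  fixes L :: "real^'n^'n" and g :: "'n \<Rightarrow> real^'p"
  assumes "compatible E L"
  shows "(\<Sum>j\<in>neighbors E i \<union> {i}. (L $ i $ j) *\<^sub>R g j) = (L ** (\<chi> j. g j)) $ i"
proof -
  have "(\<Sum>j\<in>neighbors E i \<union> {i}. (L $ i $ j) *\<^sub>R g j) = (\<Sum>j\<in>UNIV. (L $ i $ j) *\<^sub>R g j)"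
    using assms by (intro sum.mono_neutral_left) (auto simp: compatible_def neighbors_def)
  also have "\<dots> = (L ** (\<chi> j. g j)) $ i"
    by (simp add: vec_eq_iff matrix_matrix_mult_def)
  finally show ?thesis .
qed

text \<open>One round for all agents at once: the neighbor sums are the rows of a product with \<open>L\<close>.\<close>

lemma mirror_extra_state_Suc:
  fixes f :: "'n::finite \<Rightarrow> real^'p \<Rightarrow> real" and x0 :: "real^'p^'n"
  assumes "compatible E L"
    and "mirror_extra_state E L f r c x0 k = (x, y)"
    and "y' = y + L ** (\<chi> j. gradient (f j) (x $ j))"
  shows "mirror_extra_state E L f r c x0 (Suc k) = ((\<chi> i. r i) - c *\<^sub>R (2 *\<^sub>R y' - y), y')"
proof -
  have "(\<chi> i. y $ i + (\<Sum>j\<in>neighbors E i \<union> {i}. (L $ i $ j) *\<^sub>R gradient (f j) (x $ j))) = y'"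
    unfolding compatible_neighbor_sum[OF assms(1)] by (simp add: vec_eq_iff assms(3))
  then have "mirror_extra_state E L f r c x0 (Suc k)
      = (\<chi> i. r i - (2 * c) *\<^sub>R (y' $ i) + c *\<^sub>R (y $ i), y')"
    by (simp only: mirror_extra_state.simps assms(2) Let_def case_prod_conv)
  then show ?thesis
    by (simp add: vec_eq_iff algebra_simps)
qed

theorem theorem4:
  fixes f :: "'n::finite \<Rightarrow> real^'p \<Rightarrow> real"
    and r :: "'n \<Rightarrow> real^'p"
    and l :: "'n \<Rightarrow> real"
    and E :: "'n set set"
    and L :: "real^'n^'n"
    and U :: "nat \<Rightarrow> real^'n"
    and c :: real
    and x0 :: "real^'p^'n"
  assumes convex: "\<And>i. convex_on UNIV (f i)"
    and differentiable: "\<And>i x. f i differentiable (at x)"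
    and lipschitz: "\<And>i. (l i)-lipschitz_on UNIV (gradient (f i))"
    and graph: "simple_graph E" "connected_graph E"
    and compatible: "compatible E L"
    and factorization: "L = gram U"
    and full_row_rank: "full_row_rank U"
    and null_space: "null_space U = {a *\<^sub>R (\<chi> i. 1) | a. True}"
    and solvable: "optimal_solutions f r \<noteq> {}"
    and step_pos: "0 < c"
    and step_bound: "ereal c < 1 / ereal (2 * Max (range l) * lambda_max L)"
  shows "\<exists>x \<in> optimal_solutions f r. mirror_extra E L f r c x0 \<longlonglongrightarrow> x"
proof -
  obtain W :: "real^'n^'n" where L: "L = transpose W ** W"
    and "\<And>v. W *v v = 0 \<longleftrightarrow> v \<in> null_space U"
    using gram_factor[of U] factorization by metis
  then have kernel: "W *v v = 0 \<longleftrightarrow> (\<exists>a. v = a *\<^sub>R (\<chi> i. 1))" for v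
    by (simp add: null_space)
  define F where "F x = (\<Sum>i\<in>UNIV. f i (x $ i))" for x :: "real^'p^'n"
  define G where "G x = (\<chi> i. gradient (f i) (x $ i))" for x :: "real^'p^'n"
  define R where "R = (\<chi> i. r i)"
  define X where "X = mirror_extra E L f r c x0"
  define w where "w k = (\<Sum>j<k. W ** G (X j))" for k
  have optimal_iff: "x \<in> optimal_solutions f r
      \<longleftrightarrow> is_arg_min F (\<lambda>x. x - R \<in> range (\<lambda>w :: real^'p^'n. transpose W ** w)) x" for x
    unfolding optimal_solutions_def F_def range_transpose_balanced[OF kernel] by (simp add: R_def)
  have y_Suc: "transpose W ** w (Suc k) = transpose W ** w k + L ** (\<chi> i. gradient (f i) (X k $ i))" for k
    by (simp add: w_def G_def L linear_add[OF linear_matrix_mult] matrix_mul_assoc)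
  have state: "mirror_extra_state E L f r c x0 k = (X k, transpose W ** w k)" for k
  proof (induction k)
    case 0
    show ?case
      by (simp add: X_def mirror_extra_def w_def linear_0[OF linear_matrix_mult])
  next
    case (Suc k)
    show ?case
      using mirror_extra_state_Suc[OF compatible Suc y_Suc]
      by (simp add: X_def mirror_extra_def del: mirror_extra_state.simps)
  qed
  have X_Suc: "X (Suc k) = R - c *\<^sub>R (transpose W ** (2 *\<^sub>R w (Suc k) - w k))" for k
    using mirror_extra_state_Suc[OF compatible state y_Suc]
    by (simp add: state R_def linear_diff[OF linear_matrix_mult] linear_scale[OF linear_matrix_mult]
        del: mirror_extra_state.simps)
  have bound: "(norm (W *v v))\<^sup>2 \<le> lambda_max L * (norm v)\<^sup>2" for v
  proof -
    have "(norm (W *v v))\<^sup>2 = inner ((W *v v) v* W) v"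
      by (simp add: power2_norm_eq_inner dot_lmul_matrix)
    also have "\<dots> = inner v (L *v v)"
      by (simp add: L inner_commute flip: transpose_matrix_vector matrix_vector_mul_assoc)
    also have "\<dots> \<le> lambda_max L * (norm v)\<^sup>2"
      by (rule quadratic_form_le_lambda_max) (simp add: L matrix_transpose_mul)
    finally show ?thesis .
  qed
  have "0 \<le> lambda_max L"
    using order_trans[OF zero_le_power2 bound[of "axis undefined 1"]] by simp
  have "0 \<le> Max (range l)"
    using lipschitz_on_nonneg[OF lipschitz_on_separable[OF lipschitz]] .
  have step: "3 * c * Max (range l) * lambda_max L < 2"
    \<comment> \<open>If the product is 0, then \<open>step_bound\<close> reads \<open>c < \<infinity>\<close> and the claim is trivial.\<close>
  proof (cases "Max (range l) * lambda_max L = 0")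
    case False
    then have "0 < Max (range l) * lambda_max L"
      using \<open>0 \<le> lambda_max L\<close> \<open>0 \<le> Max (range l)\<close> by (simp add: less_le)
    moreover have "c < 1 / (2 * (Max (range l) * lambda_max L))"
      using step_bound False by (simp add: one_ereal_def mult.assoc)
    ultimately have "2 * (c * (Max (range l) * lambda_max L)) < 1"
      by (simp add: field_simps)
    then show ?thesis
      by (simp add: mult.assoc)
  qed (auto simp: mult.assoc)
  obtain z where z: "is_arg_min F (\<lambda>x. x - R \<in> range (\<lambda>w :: real^'p^'n. transpose W ** w)) z"
    using solvable optimal_iff by blast
  have "\<exists>z. is_arg_min F (\<lambda>x. x - R \<in> range (\<lambda>w :: real^'p^'n. transpose W ** w)) z \<and> X \<longlonglongrightarrow> z"
  proof (rule reflected_dual_iteration_converges_to_minimizer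
      [OF linear_matrix_mult linear_matrix_mult matrix_mult_adjoint norm_matrix_mult_le[OF bound]
        \<open>0 \<le> lambda_max L\<close> _ _ _ step_pos step z])
    show "convex_on UNIV F"
      unfolding F_def using convex by (rule convex_on_separable)
    show "GDERIV F x :> G x" for x
      unfolding F_def G_def by (intro GDERIV_separable GDERIV_gradient differentiable)
    show "(Max (range l))-lipschitz_on UNIV G"
      unfolding G_def using lipschitz by (rule lipschitz_on_separable)
    show "w (Suc k) = w k + W ** G (X k)" for k
      by (simp add: w_def)
  qed (rule X_Suc)
  then show ?thesis
    using optimal_iff X_def by blast
qed

end
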